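(* Assume: (1) $P_X$ and $Q_X$ have full support on $\mathcal X$ and are absolutely continuous with respect to each other; (2) the conditional distributions $P_{Y|X}$ and $Q_{Z|X}$ admit regular versions, i.e. they correspond to equivalence classes of Markov kernels $\kappa_P,\kappa_Q:\mathcal X\times\mathfrak Y\to[0,1]$; (3) $k$ is continuous and there is $k_{\max}>0$ with $k(x,x)\le k_{\max}$ for all $x\in\mathcal X$; (4) $\ell$ is characteristic; (5) there is $\gamma\ge \tfrac12$ and a representative $\tilde\kappa_P$ in the equivalence class of Markov kernels for $P_{Y|X}$ such that for every $g\in\mathcal H_\ell$ the map $x\mapsto\int_{\mathcal Y}g(y)\,\tilde\kappa_P(x,dy)$ belongs to $\mathrm{range}(C_{XX}^{\gamma})$, and the analogous condition holds for $Q_{Z|X}$ with a representative $\tilde\kappa_Q$. Then $P_{Y|X}=Q_{Z|X}$ almost surely if and only if $\|C_{Y|X}-C_{Z|X}\|_{\mathcal H_\ell\otimes\mathcal H_k}=0$.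
   Context: $P$ and $Q$ are probability measures on a measurable space $(\Omega,\mathcal F)$; $X:\Omega\to\mathcal X$ and $Y,Z:\Omega\to\mathcal Y$ are random variables, where $\mathcal X$ is a topological space with its Borel $\sigma$-algebra and $(\mathcal Y,\mathfrak Y)$ is a measurable space. $P_X,Q_X$ are the laws of $X$ under $P,Q$; $P_{Y|X}$ is the conditional distribution of $Y$ given $X$ under $P$ and $Q_{Z|X}$ that of $Z$ given $X$ under $Q$. For a fixed $\alpha\in[0,1]$, $R_X=\alpha P_X+(1-\alpha)Q_X$. Two Markov kernels are equivalent if they agree for $R_X$-almost every $x$, and "$P_{Y|X}=Q_{Z|X}$ almost surely" means $\kappa_P(x,\cdot)=\kappa_Q(x,\cdot)$ for $R_X$-almost every $x$. $k:\mathcal X\times\mathcal X\to\mathbb R$ and $\ell:\mathcal Y\times\mathcal Y\to\mathbb R$ are measurable positive definite kernels with RKHSs $\mathcal H_k$ (separable) and $\mathcal H_\ell$. $\ell$ is characteristic if the kernel mean embedding $\nu\mapsto\int \ell(\cdot,y)\,\nu(dy)\in\mathcal H_\ell$ is injective on probability measures. The (uncentered) covariance operator of $R_X$ is $C_{XX}=\mathbb E_{X\sim R_X}[k(\cdot,X)\otimes k(\cdot,X)]:\mathcal H_k\to\mathcal H_k$, i.e. $\langle f,C_{XX}f'\rangle_{\mathcal H_k}=\mathbb E_{X\sim R_X}[f(X)f'(X)]$. The conditional mean operator $C_{Y|X}:\mathcal H_k\to\mathcal H_\ell$ is the adjoint of the operator $C_{Y|X}^*:\mathcal H_\ell\to\mathcal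 H_k$, $(C_{Y|X}^*g)(x)=\int_{\mathcal Y}g(y)\,\tilde\kappa_P(x,dy)$; $C_{Z|X}$ is defined in the same way from $\tilde\kappa_Q$. $\|\cdot\|_{\mathcal H_\ell\otimes\mathcal H_k}$ is the Hilbert–Schmidt norm of operators $\mathcal H_k\to\mathcal H_\ell$. *)

theory Defs
  imports "HOL-Probability.Probability"
begin

section \<open>Measures and conditional distributions\<close>

definition mixture :: "real \<Rightarrow> 'a measure \<Rightarrow> 'a measure \<Rightarrow> 'a measure" where
  "mixture \<alpha> M N = measure_of (space M) (sets M)
     (\<lambda>A. ennreal \<alpha> * emeasure M A + ennreal (1 - \<alpha>) * emeasure N A)"

definition measure_support :: "'a::topological_space measure \<Rightarrow> 'a set" where
  "measure_support M = {x. \<forall>U. open U \<longrightarrow> x \<in> U \<longrightarrow> 0 < emeasure M U}"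

text \<open>
  The Markov kernel \<open>\<kappa>\<close> is a regular version of the conditional distribution of \<open>Y\<close> given \<open>X\<close>:
  \<open>\<kappa>(X, A)\<close> is a version of the conditional probability of the event that \<open>Y\<close> lies in \<open>A\<close>,
  given the sigma-algebra generated by \<open>X\<close>.
\<close>

definition regular_cond_dist ::
  "'w measure \<Rightarrow> ('w \<Rightarrow> 'x) \<Rightarrow> 'x measure \<Rightarrow> ('w \<Rightarrow> 'y) \<Rightarrow> 'y measure \<Rightarrow> ('x \<Rightarrow> 'y measure) \<Rightarrow> bool" where
  "regular_cond_dist M X MX Y MY \<kappa> \<longleftrightarrow>
     \<kappa> \<in> MX \<rightarrow>\<^sub>M prob_algebra MY \<and>
     (\<forall>A \<in> sets MY. AE w in M.
        real_cond_exp M (vimage_algebra (space M) X MX) (indicator (Y -` A \<inter> space M)) w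
          = measure (\<kappa> (X w)) A)"

section \<open>Reproducing kernel Hilbert spaces\<close>

definition pos_def_kernel :: "'a set \<Rightarrow> ('a \<Rightarrow> 'a \<Rightarrow> real) \<Rightarrow> bool" where
  "pos_def_kernel D k \<longleftrightarrow>
     (\<forall>x\<in>D. \<forall>y\<in>D. k x y = k y x) \<and>
     (\<forall>F c. finite F \<longrightarrow> F \<subseteq> D \<longrightarrow> 0 \<le> (\<Sum>x\<in>F. \<Sum>y\<in>F. c x * c y * k x y))"

text \<open>
  An RKHS on the domain \<open>D\<close> is presented as a Hilbert space type together with an evaluation map
  \<open>evh\<close>: the element \<open>h\<close> is the function \<open>evh h\<close> on \<open>D\<close> (values outside \<open>D\<close> are irrelevant). The map
  is linear and injective, so that it identifies the Hilbert space with a vector space of functions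
  on \<open>D\<close>; this space contains every section \<open>k(\<cdot>, x)\<close>, and the reproducing property holds. By the
  Moore-Aronszajn theorem, \<open>k\<close> determines the space of functions and its inner product.
\<close>

definition is_rkhs ::
  "'a set \<Rightarrow> ('a \<Rightarrow> 'a \<Rightarrow> real) \<Rightarrow> ('h::{real_inner, banach} \<Rightarrow> 'a \<Rightarrow> real) \<Rightarrow> bool" where
  "is_rkhs D k evh \<longleftrightarrow>
     (\<forall>h h'. \<forall>x\<in>D. evh (h + h') x = evh h x + evh h' x) \<and>
     (\<forall>c h. \<forall>x\<in>D. evh (c *\<^sub>R h) x = c * evh h x) \<and>
     (\<forall>h h'. (\<forall>x\<in>D. evh h x = evh h' x) \<longrightarrow> h = h') \<and>
     (\<forall>x\<in>D. \<exists>s. (\<forall>x'\<in>D. evh s x' = k x' x) \<and> (\<forall>h. evh h x = h \<bullet> s))"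

definition kernel_section ::
  "'a set \<Rightarrow> ('a \<Rightarrow> 'a \<Rightarrow> real) \<Rightarrow> ('h::{real_inner, banach} \<Rightarrow> 'a \<Rightarrow> real) \<Rightarrow> 'a \<Rightarrow> 'h" where
  "kernel_section D k evh x = (THE s. \<forall>x'\<in>D. evh s x' = k x' x)"

text \<open>
  The mean embedding \<open>m = \<integral> l(\<cdot>, y) \<nu>(dy)\<close> of \<open>\<nu>\<close> is taken as a weak (Pettis) integral, since the
  RKHS of \<open>l\<close> need not be separable: \<open>\<langle>g, m\<rangle> = \<integral> g d\<nu>\<close> for all \<open>g\<close>. Taking \<open>g = l(\<cdot>, y')\<close> gives
  \<open>m(y') = \<integral> l(y', y) \<nu>(dy)\<close>.
\<close>

definition has_mean_embedding ::
  "('h::{real_inner, banach} \<Rightarrow> 'a \<Rightarrow> real) \<Rightarrow> 'a measure \<Rightarrow> 'h \<Rightarrow> bool" where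
  "has_mean_embedding evh \<nu> m \<longleftrightarrow>
     (\<forall>g. integrable \<nu> (evh g) \<and> g \<bullet> m = (\<integral>y. evh g y \<partial>\<nu>))"

definition mean_embedding ::
  "('h::{real_inner, banach} \<Rightarrow> 'a \<Rightarrow> real) \<Rightarrow> 'a measure \<Rightarrow> 'h" where
  "mean_embedding evh \<nu> = (THE m. has_mean_embedding evh \<nu> m)"

text \<open>The embedding is defined on all probability measures and injective there.\<close>

definition characteristic_rkhs ::
  "'a measure \<Rightarrow> ('h::{real_inner, banach} \<Rightarrow> 'a \<Rightarrow> real) \<Rightarrow> bool" where
  "characteristic_rkhs M evh \<longleftrightarrow>
     (\<forall>\<nu> \<in> space (prob_algebra M). \<exists>m. has_mean_embedding evh \<nu> m) \<and>
     inj_on (mean_embedding evh) (space (prob_algebra M))"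

section \<open>Operators\<close>

text \<open>
  Applied to \<open>f\<close>, the rank-one operator \<open>k(\<cdot>, x) \<otimes> k(\<cdot>, x)\<close> gives
  \<open>\<langle>f, k(\<cdot>, x)\<rangle> k(\<cdot>, x) = f(x) k(\<cdot>, x)\<close>. The expectation is a Bochner integral in the RKHS, whose
  separability is the sort constraint \<open>second_countable_topology\<close>.
\<close>

definition cov_op ::
  "'x measure \<Rightarrow> ('x \<Rightarrow> 'x \<Rightarrow> real) \<Rightarrow>
   ('h::{real_inner, banach, second_countable_topology} \<Rightarrow> 'x \<Rightarrow> real) \<Rightarrow> 'h \<Rightarrow> 'h" where
  "cov_op R k evh f = (\<integral>x. evh f x *\<^sub>R kernel_section (space R) k evh x \<partial>R)"

definition orthonormal_basis :: "'h::real_inner set \<Rightarrow> bool" where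
  "orthonormal_basis E \<longleftrightarrow>
     pairwise orthogonal E \<and> (\<forall>e\<in>E. norm e = 1) \<and> closure (span E) = UNIV"

text \<open>
  Power of a diagonalizable positive operator (such as a compact one): if \<open>A e = \<lambda>\<^sub>e e\<close> on an
  orthonormal basis, then \<open>A\<^sup>\<gamma>\<close> is the bounded operator with \<open>A\<^sup>\<gamma> e = \<lambda>\<^sub>e\<^sup>\<gamma> e\<close>. It does not depend on
  the eigenbasis. For \<open>\<gamma> > 0\<close> it vanishes on the kernel of \<open>A\<close>, because \<open>0 powr \<gamma> = 0\<close>.
\<close>

definition op_power :: "('h::real_inner \<Rightarrow> 'h) \<Rightarrow> real \<Rightarrow> 'h \<Rightarrow> 'h" where
  "op_power A \<gamma> = (THE B. bounded_linear B \<and>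
     (\<exists>E lam. orthonormal_basis E \<and>
        (\<forall>e\<in>E. 0 \<le> lam e \<and> A e = lam e *\<^sub>R e \<and> B e = (lam e powr \<gamma>) *\<^sub>R e)))"

definition cond_mean_adj ::
  "('hk::{real_inner, banach} \<Rightarrow> 'x \<Rightarrow> real) \<Rightarrow> ('hl::{real_inner, banach} \<Rightarrow> 'y \<Rightarrow> real) \<Rightarrow>
   ('x \<Rightarrow> 'y measure) \<Rightarrow> 'hl \<Rightarrow> 'hk" where
  "cond_mean_adj evk evl \<kappa> g = (THE h. \<forall>x. evk h x = (\<integral>y. evl g y \<partial>\<kappa> x))"

definition cond_mean_op ::
  "('hk::{real_inner, banach} \<Rightarrow> 'x \<Rightarrow> real) \<Rightarrow> ('hl::{real_inner, banach} \<Rightarrow> 'y \<Rightarrow> real) \<Rightarrow>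
   ('x \<Rightarrow> 'y measure) \<Rightarrow> 'hk \<Rightarrow> 'hl" where
  "cond_mean_op evk evl \<kappa> = adjoint (cond_mean_adj evk evl \<kappa>)"

text \<open>
  The Hilbert-Schmidt norm does not depend on the orthonormal basis; it is infinite when the operator
  is not Hilbert-Schmidt.
\<close>

definition hs_norm :: "('h::real_inner \<Rightarrow> 'g::real_inner) \<Rightarrow> ennreal" where
  "hs_norm A = (let E = (SOME E. orthonormal_basis E) in
     if (\<lambda>e. (norm (A e))\<^sup>2) summable_on E
     then ennreal (sqrt (\<Sum>\<^sub>\<infinity>e\<in>E. (norm (A e))\<^sup>2)) else \<infinity>)"

end

theory Submission
  imports Defs
begin

text \<open>
  Functions in the RKHS of a continuous kernel are continuous, and \<open>R\<^sub>X\<close> has full support, so almost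
  surely equal kernels give the same functions \<open>C\<^sup>* g\<close>. Conversely, a vanishing Hilbert-Schmidt norm
  forces \<open>\<integral> g d\<kappa>\<^sub>P(x, \<cdot>) = \<integral> g d\<kappa>\<^sub>Q(x, \<cdot>)\<close> for all \<open>g\<close> and \<open>x\<close>, that is, equal mean embeddings, and the
  kernel \<open>l\<close> is characteristic. Here \<open>C\<^sup>*\<close> has an adjoint because it is bounded: this follows from the
  Baire category theorem, as \<open>g \<mapsto> \<langle>C\<^sup>* g, k(\<cdot>, x)\<rangle>\<close> is continuous for each \<open>x\<close> (it is the inner product
  with a mean embedding) and the sections \<open>k(\<cdot>, x)\<close> span a dense subspace.
\<close>

section \<open>Riesz representation, dense spans and orthonormal bases\<close>

text \<open>The minimizer of \<open>q x = x \<bullet> x - 2 * \<phi> x\<close> over \<open>S\<close>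
  exists by completeness, and its vanishing first variation is the representation. For
  \<open>S = UNIV\<close> this is the Riesz theorem; for \<open>\<phi>\<close> the inner product
  with \<open>h\<close>, \<open>m\<close> is the orthogonal projection of \<open>h\<close> onto
  \<open>S\<close>.\<close>

lemma riesz_closed_subspace:
  fixes S :: "'a::{real_inner, banach} set" and \<phi> :: "'a \<Rightarrow> real"
  assumes "subspace S" "closed S" "bounded_linear \<phi>"
  obtains m where "m \<in> S" "\<And>x. x \<in> S \<Longrightarrow> \<phi> x = m \<bullet> x"
proof -
  interpret \<phi>: bounded_linear \<phi> by fact
  define q where "q x = x \<bullet> x - 2 * \<phi> x" for x
  define d where "d = Inf (q ` S)"
  have S0: "0 \<in> S" using assms(1) by (simp add: subspace_0)
  obtain K where K: "\<And>x. norm (\<phi> x) \<le> norm x * K" using \<phi>.bounded by blast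
  \<comment> \<open>Completing the square: \<open>q x\<close> is at least
    \<open>(norm x - K)\<^sup>2 - K\<^sup>2\<close>.\<close>
  have "q x \<ge> - (K\<^sup>2)" for x
  proof -
    have "\<phi> x \<le> norm x * K" using K[of x] by simp
    moreover have "0 \<le> (norm x - K)\<^sup>2" by simp
    ultimately show ?thesis
      unfolding q_def by (simp add: power2_diff power2_norm_eq_inner)
  qed
  then have bdd: "bdd_below (q ` S)" by (intro bdd_belowI2)
  have dle: "d \<le> q x" if "x \<in> S" for x
    unfolding d_def using bdd that by (rule cINF_lower)
  have "\<exists>x\<in>S. q x < d + inverse (real (Suc n))" for n
  proof -
    have "Inf (q ` S) < d + inverse (real (Suc n))" by (simp add: d_def)
    then show ?thesis using cInf_less_iff[OF _ bdd] S0 by blast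
  qed
  then obtain X where X: "\<And>n. X n \<in> S" "\<And>n. q (X n) < d + inverse (real (Suc n))" by metis
  \<comment> \<open>The midpoint of \<open>x\<close> and \<open>y\<close> lies in \<open>S\<close>,
    so \<open>q\<close> is at least \<open>d\<close> there. In
    \<open>q x + q y - 2 * q ((x + y) / 2)\<close> the \<open>\<phi>\<close> terms cancel, which
    leaves half of \<open>(norm (x - y))\<^sup>2\<close>.\<close>
  have par: "(norm (x - y))\<^sup>2 \<le> 2 * (q x - d) + 2 * (q y - d)" if "x \<in> S" "y \<in> S" for x y
  proof -
    have "(1/2) *\<^sub>R (x + y) \<in> S" using assms(1) that by (simp add: subspace_add subspace_scale)
    from dle[OF this] show ?thesis
      unfolding power2_norm_eq_inner q_def
      by (simp add: \<phi>.scaleR \<phi>.add inner_add inner_diff inner_commute field_simps)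
  qed
  \<comment> \<open>By the parallelogram inequality, minimizing sequences of \<open>q\<close> are Cauchy.\<close>
  have "Cauchy X"
  proof (rule metric_CauchyI)
    fix e :: real assume "e > 0"
    \<comment> \<open>\<open>par\<close> doubles each of the two excesses over \<open>d\<close>, so
      \<open>e\<^sup>2 / 4\<close> for each gives \<open>e\<^sup>2\<close>.\<close>
    then obtain N where N: "inverse (real (Suc N)) < e\<^sup>2 / 4" using reals_Archimedean[of "e\<^sup>2/4"] by auto
    have "dist (X i) (X j) < e" if "i \<ge> N" "j \<ge> N" for i j
    proof -
      have "q (X n) - d < e\<^sup>2 / 4" if "n \<ge> N" for n
      proof -
        have "inverse (real (Suc n)) \<le> inverse (real (Suc N))" using that by simp
        then show ?thesis using X(2)[of n] N by linarith
      qed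
      from this[OF that(1)] this[OF that(2)] par[OF X(1) X(1), of i j]
      have "(norm (X i - X j))\<^sup>2 < e\<^sup>2" by argo
      then show ?thesis using \<open>e > 0\<close> by (simp add: dist_norm power_less_imp_less_base)
    qed
    then show "\<exists>N. \<forall>i\<ge>N. \<forall>j\<ge>N. dist (X i) (X j) < e" by blast
  qed
  then obtain m where m: "X \<longlonglongrightarrow> m" using Cauchy_convergent convergent_def by blast
  have mS: "m \<in> S" using closed_sequentially[OF assms(2) _ m] X(1) by blast
  have "(\<lambda>n. q (X n)) \<longlonglongrightarrow> q m"
    unfolding q_def by (intro tendsto_intros \<phi>.tendsto m)
  moreover have "(\<lambda>n. d + inverse (real (Suc n))) \<longlonglongrightarrow> d"
    using tendsto_add[OF tendsto_const LIMSEQ_inverse_real_of_nat, of d] by simp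
  ultimately have "q m \<le> d"
    by (rule LIMSEQ_le) (use X(2) less_imp_le in blast)
  have "\<phi> x = m \<bullet> x" if "x \<in> S" for x
  proof -
    define a where "a = m \<bullet> x - \<phi> x"
    \<comment> \<open>The right-hand side is \<open>q (m + t *\<^sub>R x) - q m\<close>, nonnegative
      because \<open>m\<close> minimizes \<open>q\<close> on \<open>S\<close>.\<close>
    have ge: "0 \<le> 2 * t * a + t\<^sup>2 * (x \<bullet> x)" for t
    proof -
      have "m + t *\<^sub>R x \<in> S" using assms(1) mS that by (simp add: subspace_add subspace_scale)
      from dle[OF this] \<open>q m \<le> d\<close> show ?thesis
        unfolding q_def a_def
        by (simp add: \<phi>.scaleR \<phi>.add inner_add inner_commute algebra_simps power2_eq_square)
    qed
    have "a = 0"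
    proof (rule ccontr)
      assume "a \<noteq> 0"
      \<comment> \<open>The choice \<open>t = -a/c\<close> makes the quadratic negative; the summand
        1 keeps \<open>c\<close> positive even for \<open>x = 0\<close>.\<close>
      define c where "c = 1 + x \<bullet> x"
      have c: "c > 0" unfolding c_def by (simp add: add_pos_nonneg)
      have "0 \<le> 2 * (-a/c) * a + (-a/c)\<^sup>2 * (x \<bullet> x)" by (rule ge)
      also have "\<dots> \<le> 2 * (-a/c) * a + (-a/c)\<^sup>2 * c"
        by (intro add_left_mono mult_left_mono) (auto simp: c_def)
      also have "\<dots> = - (a\<^sup>2 / c)" using c by (simp add: field_simps power2_eq_square)
      also have "\<dots> < 0" using c \<open>a \<noteq> 0\<close> by simp
      finally show False by simp
    qed
    then show ?thesis by (simp add: a_def)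
  qed
  then show thesis using that mS by blast
qed

lemma subspace_closure:
  fixes S :: "'a::real_normed_vector set"
  assumes "subspace S"
  shows "subspace (closure S)"
proof (rule subspaceI)
  show "0 \<in> closure S" using assms closure_subset subspace_0 by blast
next
  fix x y assume "x \<in> closure S" "y \<in> closure S"
  then obtain f g where fg: "\<And>n. f n \<in> S" "\<And>n. g n \<in> S" "f \<longlonglongrightarrow> x" "g \<longlonglongrightarrow> y"
    unfolding closure_sequential by blast
  have "(\<lambda>n. f n + g n) \<longlonglongrightarrow> x + y" using fg by (intro tendsto_add)
  moreover have "f n + g n \<in> S" for n using assms fg by (simp add: subspace_add)
  ultimately show "x + y \<in> closure S"
    unfolding closure_sequential by (intro exI[of _ "\<lambda>n. f n + g n"]) simp
next
  fix c :: real and x assume "x \<in> closure S"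
  then obtain f where f: "\<And>n. f n \<in> S" "f \<longlonglongrightarrow> x"
    unfolding closure_sequential by blast
  have "(\<lambda>n. c *\<^sub>R f n) \<longlonglongrightarrow> c *\<^sub>R x" using f by (intro tendsto_scaleR tendsto_const)
  moreover have "c *\<^sub>R f n \<in> S" for n using assms f by (simp add: subspace_scale)
  ultimately show "c *\<^sub>R x \<in> closure S"
    unfolding closure_sequential by (intro exI[of _ "\<lambda>n. c *\<^sub>R f n"]) simp
qed

text \<open>Subtracting from \<open>h\<close> its projection onto the closed span leaves a vector
  orthogonal to \<open>S\<close>, hence 0, so \<open>h\<close> lies in the closed span.\<close>

lemma closure_span_eq_UNIV:
  fixes S :: "'a::{real_inner, banach} set"
  assumes "\<And>x. (\<And>s. s \<in> S \<Longrightarrow> x \<bullet> s = 0) \<Longrightarrow> x = 0"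
  shows "closure (span S) = UNIV"
proof -
  have sub: "subspace (closure (span S))" by (simp add: subspace_closure)
  have "h \<in> closure (span S)" for h
  proof -
    obtain m where m: "m \<in> closure (span S)" "\<And>x. x \<in> closure (span S) \<Longrightarrow> h \<bullet> x = m \<bullet> x"
      using riesz_closed_subspace[OF sub closed_closure bounded_linear_inner_right] by blast
    have "h - m = 0"
    proof (rule assms)
      fix s assume "s \<in> S"
      then have "s \<in> closure (span S)" using closure_subset span_base by blast
      then show "(h - m) \<bullet> s = 0" using m(2) by (simp add: inner_diff)
    qed
    then show ?thesis using m(1) by simp
  qed
  then show ?thesis by blast
qed

text \<open>Zorn's lemma gives a maximal orthonormal set. A nonzero vector orthogonal to it could be
  normalized and added, so its span is dense.\<close>

lemma orthonormal_basis_exists: "\<exists>E :: 'a::{real_inner, banach} set. orthonormal_basis E"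
proof -
  define \<O> where "\<O> = {E :: 'a set. pairwise orthogonal E \<and> (\<forall>e\<in>E. norm e = 1)}"
  have "\<Union>\<C> \<in> \<O>" if "\<C> \<noteq> {}" "subset.chain \<O> \<C>" for \<C>
  proof -
    have "\<C> \<subseteq> \<O>" and tot: "\<And>A B. A \<in> \<C> \<Longrightarrow> B \<in> \<C> \<Longrightarrow> A \<subseteq> B \<or> B \<subseteq> A"
      using that(2) unfolding subset_chain_def by auto
    have "orthogonal x y" if xy: "x \<in> \<Union>\<C>" "y \<in> \<Union>\<C>" "x \<noteq> y" for x y
    proof -
      obtain A B where "A \<in> \<C>" "x \<in> A" "B \<in> \<C>" "y \<in> B" using xy by blast
      then obtain A where "A \<in> \<C>" "x \<in> A" "y \<in> A" using tot by (meson subsetD)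
      then have "pairwise orthogonal A" using \<open>\<C> \<subseteq> \<O>\<close> by (auto simp: \<O>_def)
      then show ?thesis using \<open>x \<in> A\<close> \<open>y \<in> A\<close> xy(3) by (rule pairwiseD)
    qed
    then have "pairwise orthogonal (\<Union>\<C>)" by (rule pairwiseI)
    moreover have "\<forall>e\<in>\<Union>\<C>. norm e = 1" using \<open>\<C> \<subseteq> \<O>\<close> by (auto simp: \<O>_def)
    ultimately show ?thesis by (simp add: \<O>_def)
  qed
  moreover have "{} \<in> \<O>" by (simp add: \<O>_def)
  ultimately have "\<exists>E\<in>\<O>. \<forall>F\<in>\<O>. E \<subseteq> F \<longrightarrow> F = E"
    by (intro subset_Zorn_nonempty) auto
  then obtain E where E: "E \<in> \<O>" "\<And>F. F \<in> \<O> \<Longrightarrow> E \<subseteq> F \<Longrightarrow> F = E"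
    by blast
  have "closure (span E) = UNIV"
  proof (rule closure_span_eq_UNIV, rule ccontr)
    fix x assume x: "\<And>s. s \<in> E \<Longrightarrow> x \<bullet> s = 0" and "x \<noteq> 0"
    have "orthogonal (sgn x) s" if "s \<in> E" for s
      using x[OF that] by (simp add: orthogonal_def sgn_div_norm)
    then have "insert (sgn x) E \<in> \<O>"
      using E(1) \<open>x \<noteq> 0\<close> unfolding \<O>_def
      by (simp add: pairwise_insert orthogonal_commute norm_sgn)
    then have "sgn x \<in> E" using E(2) by blast
    then have "x \<bullet> sgn x = 0" using x by blast
    then show False using \<open>x \<noteq> 0\<close> by (simp add: sgn_div_norm)
  qed
  then have "orthonormal_basis E" using E(1) by (simp add: \<O>_def orthonormal_basis_def)
  then show ?thesis by blast
qed

text \<open>The vectors orthogonal to \<open>x\<close> form a closed subspace containing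
  \<open>S\<close>, hence everything, in particular \<open>x\<close> itself.\<close>

lemma orthogonal_dense_imp_zero:
  fixes x :: "'a::real_inner"
  assumes "closure (span S) = UNIV" "\<And>s. s \<in> S \<Longrightarrow> x \<bullet> s = 0"
  shows "x = 0"
proof -
  have "closed {y. x \<bullet> y = 0}" by (intro closed_Collect_eq continuous_intros)
  moreover have "subspace {y. x \<bullet> y = 0}" by (simp add: subspace_def inner_add)
  then have "span S \<subseteq> {y. x \<bullet> y = 0}" using assms(2) by (intro span_minimal) auto
  ultimately have "x \<in> {y. x \<bullet> y = 0}" using assms(1) closure_minimal by blast
  then show ?thesis by simp
qed

section \<open>Boundedness, adjoints and the Hilbert-Schmidt norm\<close>

text \<open>A uniform boundedness argument: the sets where \<open>norm (T g)\<close> is at most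
  \<open>n\<close> are closed and cover the space, so by Baire one of them contains a ball, and
  linearity spreads the bound from the ball to the whole space.\<close>

lemma bounded_linear_if_weakly_continuous:
  fixes T :: "'a::banach \<Rightarrow> 'b::real_inner"
  assumes "linear T" "closure (span S) = UNIV"
    and S: "\<And>s. s \<in> S \<Longrightarrow> continuous_on UNIV (\<lambda>g. T g \<bullet> s)"
  shows "bounded_linear T"
proof -
  interpret T: linear T by fact
  define F where "F n = {g. norm (T g) \<le> real n}" for n
  have cont: "continuous_on UNIV (\<lambda>g. T g \<bullet> s)" if "s \<in> span S" for s
    using that
  proof (induction rule: span_induct_alt)
    case base then show ?case by simp
  next
    case (step c x y)
    then have "continuous_on UNIV (\<lambda>g. c * (T g \<bullet> x) + T g \<bullet> y)"
      by (intro continuous_on_add continuous_on_mult continuous_on_const S[OF step(1)] step(2))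
    then show ?case by (simp add: inner_add)
  qed
  \<comment> \<open>Testing only against \<open>span S\<close> expresses \<open>F n\<close> through
    continuous functions of \<open>g\<close>, so it is closed. Conversely, by density the bound
    extends to all \<open>s\<close>, and \<open>s = T g\<close> recovers the norm.\<close>
  have F_eq: "F n = (\<Inter>s\<in>span S. {g. \<bar>T g \<bullet> s\<bar> \<le> real n * norm s})" for n
  proof (intro equalityI subsetI)
    fix g assume g: "g \<in> F n"
    have "\<bar>T g \<bullet> s\<bar> \<le> real n * norm s" for s
      by (rule order_trans[OF Cauchy_Schwarz_ineq2]) (use g in \<open>simp add: F_def mult_right_mono\<close>)
    then show "g \<in> (\<Inter>s\<in>span S. {g. \<bar>T g \<bullet> s\<bar> \<le> real n * norm s})" by blast
  next
    fix g assume g: "g \<in> (\<Inter>s\<in>span S. {g. \<bar>T g \<bullet> s\<bar> \<le> real n * norm s})"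
    have "closed {s. \<bar>T g \<bullet> s\<bar> \<le> real n * norm s}" by (intro closed_Collect_le continuous_intros)
    then have "closure (span S) \<subseteq> {s. \<bar>T g \<bullet> s\<bar> \<le> real n * norm s}"
      using g by (intro closure_minimal) auto
    then have "\<bar>T g \<bullet> T g\<bar> \<le> real n * norm (T g)" using assms(2) by blast
    then have "norm (T g) * norm (T g) \<le> real n * norm (T g)" by (simp add: norm_eq_sqrt_inner)
    then show "g \<in> F n" unfolding F_def by (cases "T g = 0") auto
  qed
  have clF: "closed (F n)" for n
    unfolding F_eq by (intro closed_INT ballI closed_Collect_le continuous_intros cont)
  have UN: "\<Union>(range F) = UNIV" unfolding F_def using real_nat_ceiling_ge by blast
  have "\<exists>n. interior (F n) \<noteq> {}"
  proof (rule ccontr)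
    assume "\<not> ?thesis"
    then have "euclidean interior_of \<Union>(range F) = {}"
      by (intro Baire_category_alt)
         (auto simp: completely_metrizable_space_euclidean clF closed_closedin[symmetric])
    then show False by (simp add: UN)
  qed
  then obtain n g0 where "g0 \<in> interior (F n)" by blast
  then obtain e where e: "e > 0" "cball g0 e \<subseteq> F n" by (meson mem_interior_cball)
  have "norm (T g) \<le> norm g * (2 * real n / e)" for g
  proof (cases "g = 0")
    case False
    \<comment> \<open>\<open>h\<close> is \<open>g\<close> rescaled to norm \<open>e\<close>. Both
      \<open>g0 + h\<close> and \<open>g0\<close> lie in \<open>F n\<close>, so their difference
      costs the factor 2.\<close>
    define h where "h = (e / norm g) *\<^sub>R g"
    have "g0 + h \<in> F n" "g0 \<in> F n" using e False by (auto simp: h_def dist_norm)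
    then have "norm (T h) \<le> 2 * real n"
      using norm_triangle_ineq4[of "T (g0 + h)" "T g0"] by (auto simp: F_def T.add)
    moreover have "norm (T h) = e / norm g * norm (T g)" using e by (simp add: h_def T.scale)
    ultimately show ?thesis using e False by (simp add: field_simps)
  qed (simp add: T.zero)
  then show ?thesis by (intro bounded_linear_intro T.add T.scale)
qed

text \<open>\<open>adjoint\<close> is a choice operator, so it has its defining property only once
  some adjoint exists; Riesz representation of each functional
  \<open>\<lambda>x. T x \<bullet> y\<close> supplies one.\<close>

lemma inner_adjoint_bounded_linear:
  fixes T :: "'a::{real_inner, banach} \<Rightarrow> 'b::real_inner"
  assumes "bounded_linear T"
  shows "T x \<bullet> y = x \<bullet> adjoint T y"
proof -
  have "\<exists>m. \<forall>x. T x \<bullet> y = x \<bullet> m" for y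
  proof -
    have "bounded_linear (\<lambda>x. T x \<bullet> y)"
      using bounded_linear_compose[OF bounded_linear_inner_left assms] .
    from riesz_closed_subspace[OF subspace_UNIV closed_UNIV this]
    show ?thesis by (metis UNIV_I inner_commute)
  qed
  then have "\<exists>T'. \<forall>x y. T x \<bullet> y = x \<bullet> T' y" by metis
  then show ?thesis unfolding adjoint_def by (rule someI2_ex) blast
qed

text \<open>\<open>A\<close> vanishes on an orthonormal basis, so \<open>B x\<close> is orthogonal
  to that basis and therefore 0.\<close>

lemma hs_norm_eq_0_imp:
  fixes A :: "'h::{real_inner, banach} \<Rightarrow> 'g::real_inner"
  assumes "hs_norm A = 0" and adj: "\<And>x y. B x \<bullet> y = x \<bullet> A y"
  shows "B x = 0"
proof -
  define E where "E = (SOME E :: 'h set. orthonormal_basis E)"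
  have E: "orthonormal_basis E" unfolding E_def using orthonormal_basis_exists by (rule someI_ex)
  \<comment> \<open>The non-summable branch of \<open>hs_norm\<close> has the value infinity and is
    thereby excluded.\<close>
  have sm: "(\<lambda>e. (norm (A e))\<^sup>2) summable_on E" and "(\<Sum>\<^sub>\<infinity>e\<in>E. (norm (A e))\<^sup>2) \<le> 0"
    using assms(1) unfolding hs_norm_def Let_def E_def[symmetric]
    by (auto split: if_splits simp: ennreal_eq_0_iff)
  then have "A e = 0" if "e \<in> E" for e
    using nonneg_infsum_le_0D[OF _ sm _ that] by simp
  then show ?thesis
    using E adj orthogonal_dense_imp_zero[of E "B x"] by (simp add: orthonormal_basis_def)
qed

lemma hs_norm_zero: "hs_norm (\<lambda>h. 0) = 0"
  by (simp add: hs_norm_def Let_def)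

section \<open>Mixtures and full support\<close>

lemma emeasure_mixture:
  assumes "sets N = sets M" "A \<in> sets M"
  shows "emeasure (mixture \<alpha> M N) A = ennreal \<alpha> * emeasure M A + ennreal (1 - \<alpha>) * emeasure N A"
proof (rule emeasure_measure_of[OF mixture_def])
  show "sets M \<subseteq> Pow (space M)" by (rule sets.space_closed)
  show "A \<in> sets (mixture \<alpha> M N)" using assms(2) by (simp add: mixture_def)
  show "positive (sets (mixture \<alpha> M N))
     (\<lambda>A. ennreal \<alpha> * emeasure M A + ennreal (1 - \<alpha>) * emeasure N A)"
    by (simp add: positive_def)
  show "countably_additive (sets (mixture \<alpha> M N))
     (\<lambda>A. ennreal \<alpha> * emeasure M A + ennreal (1 - \<alpha>) * emeasure N A)"
    by (auto simp: countably_additive_def mixture_def assms(1) suminf_emeasure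
        suminf_add[symmetric] ennreal_suminf_cmult)
qed

lemma sets_mixture [simp]: "sets (mixture \<alpha> M N) = sets M"
  by (simp add: mixture_def)

text \<open>At least one of the two weights is positive, and both measures charge every nonempty
  open set.\<close>

lemma measure_support_mixture:
  assumes "sets M = sets borel" "sets N = sets borel" "0 \<le> \<alpha>" "\<alpha> \<le> 1"
    and "measure_support M = UNIV" "measure_support N = UNIV"
  shows "measure_support (mixture \<alpha> M N) = UNIV"
proof -
  have "0 < emeasure (mixture \<alpha> M N) U" if "open U" "x \<in> U" for U x
  proof -
    have "0 < emeasure M U" "0 < emeasure N U"
      using assms(5,6) that unfolding measure_support_def by blast+
    moreover have "0 < \<alpha> \<or> 0 < 1 - \<alpha>" by linarith
    ultimately show ?thesis
      using assms(1,2) that(1) by (auto simp: emeasure_mixture ennreal_zero_less_mult_iff zero_less_iff_neq_zero)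
  qed
  then show ?thesis unfolding measure_support_def by blast
qed

text \<open>The complement of \<open>C\<close> is an open null set, and full support leaves only the
  empty one.\<close>

lemma AE_imp_everywhere_closed:
  assumes "measure_support M = UNIV" "sets M = sets borel" "closed C" "AE x in M. x \<in> C"
  shows "x \<in> C"
proof (rule ccontr)
  assume "x \<notin> C"
  have "open (- C)" using assms(3) by auto
  then have "0 < emeasure M (- C)" using assms(1) \<open>x \<notin> C\<close> unfolding measure_support_def by blast
  moreover have "emeasure M (- C) = 0"
    using assms(2,4) \<open>open (- C)\<close> by (subst (asm) AE_iff_null) (auto simp: null_setsD1 sets_eq_imp_space_eq Compl_eq)
  ultimately show False by simp
qed

section \<open>Sections and functions of an RKHS\<close>

context
  fixes D :: "'a set" and k :: "'a \<Rightarrow> 'a \<Rightarrow> real" and evh :: "'h::{real_inner, banach} \<Rightarrow> 'a \<Rightarrow> real"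
  assumes rkhs: "is_rkhs D k evh"
begin

lemma rkhs_add: "x \<in> D \<Longrightarrow> evh (h + h') x = evh h x + evh h' x"
  and rkhs_scale: "x \<in> D \<Longrightarrow> evh (c *\<^sub>R h) x = c * evh h x"
  and rkhs_eqI: "(\<And>x. x \<in> D \<Longrightarrow> evh h x = evh h' x) \<Longrightarrow> h = h'"
  using rkhs unfolding is_rkhs_def by blast+

text \<open>Choosing one section per point gives a feature map \<open>s\<close> for
  \<open>k\<close>.\<close>

lemma rkhs_section:
  "\<exists>s. (\<forall>x\<in>D. \<forall>h. evh h x = h \<bullet> s x) \<and> (\<forall>x\<in>D. \<forall>y\<in>D. s x \<bullet> s y = k x y)"
proof -
  have "\<forall>x\<in>D. \<exists>s. (\<forall>x'\<in>D. evh s x' = k x' x) \<and> (\<forall>h. evh h x = h \<bullet> s)"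
    using rkhs unfolding is_rkhs_def by blast
  then obtain s where s: "\<forall>x\<in>D. (\<forall>x'\<in>D. evh (s x) x' = k x' x) \<and> (\<forall>h. evh h x = h \<bullet> s x)"
    by metis
  then have "s x \<bullet> s y = k x y" if "x \<in> D" "y \<in> D" for x y
    using that by (metis inner_commute)
  with s show ?thesis by blast
qed

text \<open>An element orthogonal to all sections is the zero function on \<open>D\<close>, hence
  0.\<close>

lemma rkhs_sections_dense:
  assumes "\<And>x h. x \<in> D \<Longrightarrow> evh h x = h \<bullet> s x"
  shows "closure (span (s ` D)) = UNIV"
proof (rule closure_span_eq_UNIV)
  fix h assume "\<And>t. t \<in> s ` D \<Longrightarrow> h \<bullet> t = 0"
  then show "h = 0" by (intro rkhs_eqI) (simp add: assms)
qed

end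

text \<open>The feature map is continuous, since the squared distance of \<open>s y\<close> and
  \<open>s x\<close> is \<open>k y y - 2 * k y x + k x x\<close>, which tends to 0 as
  \<open>y\<close> tends to \<open>x\<close>.\<close>

lemma rkhs_continuous:
  fixes k :: "'x::topological_space \<Rightarrow> 'x \<Rightarrow> real"
  assumes "is_rkhs UNIV k evh" and k: "continuous_on UNIV (\<lambda>(x, x'). k x x')"
  shows "continuous_on UNIV (evh h)"
proof -
  obtain s where "\<forall>x\<in>UNIV. \<forall>h. evh h x = h \<bullet> s x" "\<forall>x\<in>UNIV. \<forall>y\<in>UNIV. s x \<bullet> s y = k x y"
    using rkhs_section[OF assms(1)] by (elim exE conjE)
  then have s: "evh h x = h \<bullet> s x" "s x \<bullet> s y = k x y" for h x y by simp_all
  have k2: "continuous_on UNIV (\<lambda>x. k (f x) (g x))" if "continuous_on UNIV f" "continuous_on UNIV g"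
    for f g :: "'x \<Rightarrow> 'x"
    using continuous_on_compose2[OF k continuous_on_Pair[OF that]] by simp
  have "continuous_on UNIV s"
    unfolding continuous_on_def
  proof
    fix x
    have "continuous_on UNIV (\<lambda>y. sqrt (k y y - 2 * k y x + k x x))"
      by (intro continuous_intros k2)
    then have "((\<lambda>y. sqrt (k y y - 2 * k y x + k x x)) \<longlongrightarrow> sqrt (k x x - 2 * k x x + k x x)) (at x within UNIV)"
      unfolding continuous_on_def by blast
    moreover have "dist (s y) (s x) = sqrt (k y y - 2 * k y x + k x x)" for y
      using s(2)[of x y] s(2)[of y x]
      by (simp add: dist_norm norm_eq_sqrt_inner inner_diff s(2) inner_commute)
    ultimately have "((\<lambda>y. dist (s y) (s x)) \<longlongrightarrow> 0) (at x within UNIV)"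
      by (simp only:) simp
    then show "(s \<longlongrightarrow> s x) (at x within UNIV)"
      by (subst tendsto_dist_iff)
  qed
  then have "continuous_on UNIV (\<lambda>x. h \<bullet> s x)" by (intro continuous_intros)
  then show ?thesis by (simp only: s(1)[symmetric])
qed

section \<open>Mean embeddings and conditional mean operators\<close>

lemma characteristic_rkhs_mean:
  assumes "characteristic_rkhs M evh" "\<nu> \<in> space (prob_algebra M)"
  shows "integrable \<nu> (evh g)" "\<exists>m. \<forall>g. (\<integral>y. evh g y \<partial>\<nu>) = g \<bullet> m"
  using assms unfolding characteristic_rkhs_def has_mean_embedding_def by metis+

text \<open>With equal integrals, the predicates \<open>has_mean_embedding evh \<nu>\<close> and
  \<open>has_mean_embedding evh \<nu>'\<close> coincide, hence so do the embeddings they describe;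
  injectivity then applies.\<close>

lemma characteristic_rkhs_eqI:
  assumes ch: "characteristic_rkhs M evh" and \<nu>: "\<nu> \<in> space (prob_algebra M)" "\<nu>' \<in> space (prob_algebra M)"
    and eq: "\<And>g. (\<integral>y. evh g y \<partial>\<nu>) = (\<integral>y. evh g y \<partial>\<nu>')"
  shows "\<nu> = \<nu>'"
proof -
  have "integrable \<nu> (evh g)" "integrable \<nu>' (evh g)" for g
    using characteristic_rkhs_mean(1)[OF ch] \<nu> by simp_all
  then have "mean_embedding evh \<nu> = mean_embedding evh \<nu>'"
    unfolding mean_embedding_def has_mean_embedding_def by (simp add: eq)
  then show ?thesis using ch \<nu> unfolding characteristic_rkhs_def inj_on_def by blast
qed

text \<open>The description in \<open>cond_mean_adj\<close> is proper: the range assumption gives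
  existence, injectivity of evaluation gives uniqueness.\<close>

lemma evaluation_cond_mean_adj:
  assumes "is_rkhs UNIV k evk" and "(\<lambda>x. \<integral>y. evl g y \<partial>\<kappa> x) \<in> range evk"
  shows "evk (cond_mean_adj evk evl \<kappa> g) x = (\<integral>y. evl g y \<partial>\<kappa> x)"
proof -
  obtain h where "(\<lambda>x. \<integral>y. evl g y \<partial>\<kappa> x) = evk h" using assms(2) by (rule imageE)
  then have h: "\<forall>x. evk h x = (\<integral>y. evl g y \<partial>\<kappa> x)" by (simp add: fun_eq_iff)
  then have "\<exists>!h. \<forall>x. evk h x = (\<integral>y. evl g y \<partial>\<kappa> x)"
    using rkhs_eqI[OF assms(1)] by (intro ex1I[of _ h]) auto
  from theI'[OF this] show ?thesis unfolding cond_mean_adj_def by blast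
qed

lemma bounded_linear_cond_mean_adj:
  fixes evk :: "'hk::{real_inner, banach} \<Rightarrow> 'x::topological_space \<Rightarrow> real"
  assumes k: "is_rkhs UNIV k evk" and l: "is_rkhs (space M) l evl"
    and ch: "characteristic_rkhs M evl"
    and \<kappa>: "\<And>x. \<kappa> x \<in> space (prob_algebra M)"
    and range: "\<And>g. (\<lambda>x. \<integral>y. evl g y \<partial>\<kappa> x) \<in> range evk"
  shows "bounded_linear (cond_mean_adj evk evl \<kappa>)"
proof -
  let ?T = "cond_mean_adj evk evl \<kappa>"
  obtain s where "\<forall>x\<in>UNIV. \<forall>h. evk h x = h \<bullet> s x"
    using rkhs_section[OF k] by (elim exE conjE)
  then have s: "evk h x = h \<bullet> s x" for h x by simp
  have ev: "evk (?T g) x = (\<integral>y. evl g y \<partial>\<kappa> x)" for g x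
    by (rule evaluation_cond_mean_adj[OF k range])
  \<comment> \<open>Evaluation in the RKHS of \<open>l\<close> is linear only at points of
    \<open>space M\<close>, so the integrands below must be compared on exactly this set.\<close>
  have sp: "space (\<kappa> x) = space M" for x
    using \<kappa>[of x] by (auto simp: space_prob_algebra dest: sets_eq_imp_space_eq)
  have int: "integrable (\<kappa> x) (evl g)" for x g
    by (rule characteristic_rkhs_mean(1)[OF ch \<kappa>])
  have "linear ?T"
  proof (rule linearI)
    fix g g'
    show "?T (g + g') = ?T g + ?T g'"
    proof (rule rkhs_eqI[OF k])
      fix x
      have "(\<integral>y. evl (g + g') y \<partial>\<kappa> x) = (\<integral>y. evl g y + evl g' y \<partial>\<kappa> x)"
        by (rule Bochner_Integration.integral_cong) (simp_all add: sp rkhs_add[OF l])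
      then show "evk (?T (g + g')) x = evk (?T g + ?T g') x"
        by (simp add: ev int rkhs_add[OF k])
    qed
  next
    fix c g
    show "?T (c *\<^sub>R g) = c *\<^sub>R ?T g"
    proof (rule rkhs_eqI[OF k])
      fix x
      have "(\<integral>y. evl (c *\<^sub>R g) y \<partial>\<kappa> x) = (\<integral>y. c * evl g y \<partial>\<kappa> x)"
        by (rule Bochner_Integration.integral_cong) (simp_all add: sp rkhs_scale[OF l])
      then show "evk (?T (c *\<^sub>R g)) x = evk (c *\<^sub>R ?T g) x"
        by (simp add: ev rkhs_scale[OF k])
    qed
  qed
  moreover have "closure (span (s ` UNIV)) = UNIV"
    using rkhs_sections_dense[OF k s] .
  moreover have "continuous_on UNIV (\<lambda>g. ?T g \<bullet> t)" if t: "t \<in> s ` UNIV" for t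
  proof -
    obtain x where x: "t = s x" using t by blast
    \<comment> \<open>\<open>m\<close> is the mean embedding of \<open>\<kappa> x\<close>, which
      represents pairing with the section at \<open>x\<close>.\<close>
    obtain m where "\<forall>g. (\<integral>y. evl g y \<partial>\<kappa> x) = g \<bullet> m"
      using characteristic_rkhs_mean(2)[OF ch \<kappa>[of x]] by blast
    then have "?T g \<bullet> t = g \<bullet> m" for g
      using ev[of g x] s[of "?T g" x] by (simp only: x)
    moreover have "continuous_on UNIV (\<lambda>g. g \<bullet> m)" by (intro continuous_intros)
    ultimately show ?thesis by (simp only:)
  qed
  ultimately show ?thesis by (rule bounded_linear_if_weakly_continuous)
qed

section \<open>Equality of kernels versus equality of conditional mean operators\<close>

theorem theorem3p1:
  fixes P Q :: "'w measure"
    and X :: "'w \<Rightarrow> 'x::topological_space"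
    and Y Z :: "'w \<Rightarrow> 'y" and MY :: "'y measure"
    and \<alpha> :: real
    and k :: "'x \<Rightarrow> 'x \<Rightarrow> real" and l :: "'y \<Rightarrow> 'y \<Rightarrow> real"
    and evk :: "'hk::{real_inner, banach, second_countable_topology} \<Rightarrow> 'x \<Rightarrow> real"
    and evl :: "'hl::{real_inner, banach} \<Rightarrow> 'y \<Rightarrow> real"
    and \<kappa>P \<kappa>Q \<kappa>P' \<kappa>Q' :: "'x \<Rightarrow> 'y measure"
    and kmax \<gamma>P \<gamma>Q :: real
  defines "PX \<equiv> distr P borel X"
    and "QX \<equiv> distr Q borel X"
  defines "RX \<equiv> mixture \<alpha> PX QX"
  assumes "prob_space P" and "prob_space Q" and "sets Q = sets P"
    and "X \<in> P \<rightarrow>\<^sub>M borel" and "Y \<in> P \<rightarrow>\<^sub>M MY" and "Z \<in> P \<rightarrow>\<^sub>M MY"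
    and "0 \<le> \<alpha>" and "\<alpha> \<le> 1"
    and "pos_def_kernel UNIV k" and "(\<lambda>(x, x'). k x x') \<in> borel \<Otimes>\<^sub>M borel \<rightarrow>\<^sub>M borel"
    and "is_rkhs UNIV k evk"
    and "pos_def_kernel (space MY) l" and "(\<lambda>(y, y'). l y y') \<in> MY \<Otimes>\<^sub>M MY \<rightarrow>\<^sub>M borel"
    and "is_rkhs (space MY) l evl"
    and "measure_support PX = UNIV" and "measure_support QX = UNIV"
    and "absolutely_continuous PX QX" and "absolutely_continuous QX PX"
    and "regular_cond_dist P X borel Y MY \<kappa>P" and "regular_cond_dist Q X borel Z MY \<kappa>Q"
    and "continuous_on UNIV (\<lambda>(x, x'). k x x')" and "0 < kmax" and "\<forall>x. k x x \<le> kmax"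
    and "characteristic_rkhs MY evl"
    and "1 / 2 \<le> \<gamma>P" and "\<kappa>P' \<in> borel \<rightarrow>\<^sub>M prob_algebra MY" and "AE x in RX. \<kappa>P' x = \<kappa>P x"
    and "\<forall>g. (\<lambda>x. \<integral>y. evl g y \<partial>\<kappa>P' x) \<in> evk ` range (op_power (cov_op RX k evk) \<gamma>P)"
    and "1 / 2 \<le> \<gamma>Q" and "\<kappa>Q' \<in> borel \<rightarrow>\<^sub>M prob_algebra MY" and "AE x in RX. \<kappa>Q' x = \<kappa>Q x"
    and "\<forall>g. (\<lambda>x. \<integral>y. evl g y \<partial>\<kappa>Q' x) \<in> evk ` range (op_power (cov_op RX k evk) \<gamma>Q)"
  shows "(AE x in RX. \<kappa>P x = \<kappa>Q x) \<longleftrightarrow>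
         hs_norm (\<lambda>h. cond_mean_op evk evl \<kappa>P' h - cond_mean_op evk evl \<kappa>Q' h) = 0"
proof -
  note rk = \<open>is_rkhs UNIV k evk\<close> and rl = \<open>is_rkhs (space MY) l evl\<close>
    and ch = \<open>characteristic_rkhs MY evl\<close>
  let ?TP = "cond_mean_adj evk evl \<kappa>P'" and ?TQ = "cond_mean_adj evk evl \<kappa>Q'"
  have \<kappa>: "\<kappa>P' x \<in> space (prob_algebra MY)" "\<kappa>Q' x \<in> space (prob_algebra MY)" for x
    using \<open>\<kappa>P' \<in> borel \<rightarrow>\<^sub>M prob_algebra MY\<close> \<open>\<kappa>Q' \<in> borel \<rightarrow>\<^sub>M prob_algebra MY\<close>
    by (auto dest: measurable_space)
  have range: "(\<lambda>x. \<integral>y. evl g y \<partial>\<kappa>P' x) \<in> range evk" "(\<lambda>x. \<integral>y. evl g y \<partial>\<kappa>Q' x) \<in> range evk" for g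
    using \<open>\<forall>g. (\<lambda>x. \<integral>y. evl g y \<partial>\<kappa>P' x) \<in> _\<close> \<open>\<forall>g. (\<lambda>x. \<integral>y. evl g y \<partial>\<kappa>Q' x) \<in> _\<close> by blast+
  have ev: "evk (?TP g) x = (\<integral>y. evl g y \<partial>\<kappa>P' x)" "evk (?TQ g) x = (\<integral>y. evl g y \<partial>\<kappa>Q' x)" for g x
    by (rule evaluation_cond_mean_adj[OF rk range(1)], rule evaluation_cond_mean_adj[OF rk range(2)])
  \<comment> \<open>Both kernels may be replaced by their representatives, which changes them only
    on null sets of \<open>RX\<close>.\<close>
  have AE': "(AE x in RX. \<kappa>P x = \<kappa>Q x) \<longleftrightarrow> (AE x in RX. \<kappa>P' x = \<kappa>Q' x)"
    using \<open>AE x in RX. \<kappa>P' x = \<kappa>P x\<close> \<open>AE x in RX. \<kappa>Q' x = \<kappa>Q x\<close>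
    by (intro iffI; elim eventually_rev_mp eventually_mono; auto)
  show ?thesis
    unfolding AE'
  proof
    assume AE: "AE x in RX. \<kappa>P' x = \<kappa>Q' x"
    have supp: "measure_support RX = UNIV"
      unfolding RX_def by (rule measure_support_mixture) (use assms in \<open>simp_all add: PX_def QX_def\<close>)
    have "?TP g = ?TQ g" for g
    proof (rule rkhs_eqI[OF rk])
      fix x
      \<comment> \<open>Both sides are continuous in \<open>x\<close>, so the agreement set is
        closed, and full support turns almost sure agreement into agreement everywhere.\<close>
      have "x \<in> {x. evk (?TP g) x = evk (?TQ g) x}"
      proof (rule AE_imp_everywhere_closed[OF supp])
        show "sets RX = sets borel" by (simp add: RX_def PX_def)
        show "closed {x. evk (?TP g) x = evk (?TQ g) x}"
          by (intro closed_Collect_eq rkhs_continuous[OF rk] assms)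
        show "AE x in RX. x \<in> {x. evk (?TP g) x = evk (?TQ g) x}"
          using AE by eventually_elim (simp add: ev)
      qed
      then show "evk (?TP g) x = evk (?TQ g) x" by simp
    qed
    then have "?TP = ?TQ" by blast
    then show "hs_norm (\<lambda>h. cond_mean_op evk evl \<kappa>P' h - cond_mean_op evk evl \<kappa>Q' h) = 0"
      by (simp add: cond_mean_op_def hs_norm_zero)
  next
    assume "hs_norm (\<lambda>h. cond_mean_op evk evl \<kappa>P' h - cond_mean_op evk evl \<kappa>Q' h) = 0"
    \<comment> \<open>The difference of the operators is adjoint to the difference of
      \<open>?TP\<close> and \<open>?TQ\<close>, as \<open>hs_norm_eq_0_imp\<close>
      requires.\<close>
    moreover have "(?TP g - ?TQ g) \<bullet> h = g \<bullet> (cond_mean_op evk evl \<kappa>P' h - cond_mean_op evk evl \<kappa>Q' h)"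
      for g h
      using inner_adjoint_bounded_linear[OF bounded_linear_cond_mean_adj[OF rk rl ch \<kappa>(1) range(1)]]
        inner_adjoint_bounded_linear[OF bounded_linear_cond_mean_adj[OF rk rl ch \<kappa>(2) range(2)]]
      by (simp add: cond_mean_op_def inner_diff)
    ultimately have "?TP g - ?TQ g = 0" for g by (rule hs_norm_eq_0_imp)
    then have "?TP g = ?TQ g" for g by (metis right_minus_eq)
    then have "(\<integral>y. evl g y \<partial>\<kappa>P' x) = (\<integral>y. evl g y \<partial>\<kappa>Q' x)" for g x
      using ev(1)[of g x] ev(2)[of g x] by simp
    \<comment> \<open>All RKHS functions have equal integrals, so the mean embeddings agree at every
      \<open>x\<close>, not merely almost surely.\<close>
    then have "\<kappa>P' x = \<kappa>Q' x" for x by (intro characteristic_rkhs_eqI[OF ch \<kappa>])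
    then show "AE x in RX. \<kappa>P' x = \<kappa>Q' x" by simp
  qed
qed

end
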